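(* If an $r$-uniform connected hypergraph $\mathbb H=(V,\mathcal H)$ has transversal number $\tau(\mathbb H)=1$, then it is non-stabilizable.
   Context: A hypergraph $\mathbb H=(V,\mathcal H)$ consists of a finite node set $V$ and a finite set $\mathcal H$ of subsets of $V$ (hyperedges) with union $V$. All hypergraphs are assumed simple (no hyperedge is contained in another one) and connected (the graph whose vertices are the hyperedges, with two hyperedges adjacent when they intersect, is connected). $\mathbb H$ is $r$-uniform if all hyperedges have cardinality $r$. A transversal is a set $T\subset V$ meeting every hyperedge; $\tau(\mathbb H)$ is the minimal cardinality of a transversal. $\mathscr M(V)$ is the set of probability measures $\mu$ on $V$ with $\mu(i)>0$ for all $i$. Matching model $(\mathbb H,\Phi,\mu)$: at each time $n\ge1$ one item enters; its class $C_n\in V$ is drawn from $\mu$, i.i.d. If the buffer contains a set of items whose classes form, together with $C_n$, a hyperedge (one item per class), the policy $\Phi$ selects one such set and these items leave immediately together with the incoming item (a match is always performed whenever possible); otherwise the incoming item is stored. $W_n$ is the word over $V$ listing the classes of unmatched items after the arrival at time $n$, in order of arrival; it takes values in the set of words in which, for each hyperedge, some class of the hyperedge does not occur. $\Phi$ is admissible if the choice of the match depends solely on the queue detail (the word) upon arrival and the incoming class, and possibly on an independent uniform draw in case of a tie; then $(W_n)$ is a Markov chain. The model is stable if $(W_n)$ is positive recurrent; $\mathrm{Stab}(\mathbb H,\Phi)$ is the set of $\mu\in\mathscr M(V)$ for which it is stable. $\mathbb H$ is non-stabilizable if $\mathrm{Stab}(\mathbb H,\Phi)=\emptyset$ for every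 admissible $\Phi$.
   Formalization: The formal theorem assumes r ≥ 2; for r = 1 the claim fails, since the hypergraph with one node v and one hyperedge {v} has transversal number 1 but its buffer is always empty, hence the model is stable. *)

theory Defs
  imports "HOL-Probability.Probability"
begin

section \<open>Hypergraphs\<close>

definition hypergraph :: "'v set \<Rightarrow> 'v set set \<Rightarrow> bool" where
  "hypergraph V H \<longleftrightarrow> finite V \<and> finite H \<and> \<Union>H = V"

definition simple_hypergraph :: "'v set set \<Rightarrow> bool" where
  "simple_hypergraph H \<longleftrightarrow> (\<forall>h\<in>H. \<forall>h'\<in>H. h \<subseteq> h' \<longrightarrow> h = h')"

definition connected_hypergraph :: "'v set set \<Rightarrow> bool" where
  "connected_hypergraph H \<longleftrightarrow>
     (\<forall>h\<in>H. \<forall>h'\<in>H. (h, h') \<in> {(a, b). a \<in> H \<and> b \<in> H \<and> a \<inter> b \<noteq> {}}\<^sup>*)"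

definition uniform_hypergraph :: "nat \<Rightarrow> 'v set set \<Rightarrow> bool" where
  "uniform_hypergraph r H \<longleftrightarrow> (\<forall>h\<in>H. card h = r)"

definition transversals :: "'v set \<Rightarrow> 'v set set \<Rightarrow> 'v set set" where
  "transversals V H = {T. T \<subseteq> V \<and> (\<forall>h\<in>H. T \<inter> h \<noteq> {})}"

definition transversal_number :: "'v set \<Rightarrow> 'v set set \<Rightarrow> nat" where
  "transversal_number V H = Min (card ` transversals V H)"


section \<open>The matching model\<close>

definition positive_prob_measures :: "'v set \<Rightarrow> 'v measure set" where
  "positive_prob_measures V =
     {\<mu>. prob_space \<mu> \<and> space \<mu> = V \<and> sets \<mu> = Pow V \<and> (\<forall>i\<in>V. measure \<mu> {i} > 0)}"

definition buffer_words :: "'v set \<Rightarrow> 'v set set \<Rightarrow> 'v list set" where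
  "buffer_words V H = {w \<in> lists V. \<forall>h\<in>H. \<exists>i\<in>h. i \<notin> set w}"

text \<open>
  Buffered items are identified with their positions in the word \<open>w\<close>, so a possible match
  for an incoming item of class \<open>c\<close> is a set \<open>I\<close> of positions. Injectivity and
  \<open>c \<notin> (!) w ` I\<close> say that the match contains exactly one item of each class.
\<close>

definition possible_matches :: "'v set set \<Rightarrow> 'v list \<Rightarrow> 'v \<Rightarrow> nat set set" where
  "possible_matches H w c =
     {I. I \<subseteq> {..<length w} \<and> inj_on ((!) w) I \<and> c \<notin> (!) w ` I \<and> insert c ((!) w ` I) \<in> H}"

text \<open>
  A policy maps the queue detail upon arrival, the incoming class and the value of an
  independent draw, uniform on \<open>[0,1]\<close>, to the selected match. Policies without random
  tie-breaking ignore the last argument. The value is irrelevant if no match is possible.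
\<close>

type_synonym 'v policy = "'v list \<Rightarrow> 'v \<Rightarrow> real \<Rightarrow> nat set"

text \<open>
  Membership in the function space below says both that the selected match is always a possible
  one and that the selection is a measurable function of the uniform draw.
\<close>

definition admissible :: "'v set \<Rightarrow> 'v set set \<Rightarrow> 'v policy \<Rightarrow> bool" where
  "admissible V H \<Phi> \<longleftrightarrow>
     (\<forall>w\<in>buffer_words V H. \<forall>c\<in>V. possible_matches H w c \<noteq> {} \<longrightarrow>
        \<Phi> w c \<in> borel \<rightarrow>\<^sub>M count_space (possible_matches H w c))"

definition step :: "'v set set \<Rightarrow> 'v policy \<Rightarrow> 'v list \<Rightarrow> 'v \<times> real \<Rightarrow> 'v list" where
  "step H \<Phi> w = (\<lambda>(c, u).
     if possible_matches H w c = {} then w @ [c] else nths w (- \<Phi> w c u))"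

text \<open>The draws \<open>(C\<^sub>n, U\<^sub>n)\<close>, \<open>n \<ge> 1\<close>, are i.i.d.; the pair of time \<open>n\<close> is entry \<open>n - 1\<close> of the stream.\<close>

definition draws :: "'v measure \<Rightarrow> ('v \<times> real) stream measure" where
  "draws \<mu> = stream_space (\<mu> \<Otimes>\<^sub>M uniform_measure lborel {0..1})"

primrec queue :: "'v set set \<Rightarrow> 'v policy \<Rightarrow> 'v list \<Rightarrow> ('v \<times> real) stream \<Rightarrow> nat \<Rightarrow> 'v list" where
  "queue H \<Phi> w \<omega> 0 = w"
| "queue H \<Phi> w \<omega> (Suc n) = step H \<Phi> (queue H \<Phi> w \<omega> n) (\<omega> !! n)"

definition return_time :: "'v set set \<Rightarrow> 'v policy \<Rightarrow> 'v list \<Rightarrow> ('v \<times> real) stream \<Rightarrow> enat" where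
  "return_time H \<Phi> w \<omega> = (INF n\<in>{n. n \<ge> 1 \<and> queue H \<Phi> w \<omega> n = w}. enat n)"

text \<open>
  Positive recurrence: every state has finite mean return time. On \<open>buffer_words V H\<close>, every
  state can be reached from the empty word, by letting the items arrive in the order of the word.
\<close>

definition stable :: "'v set \<Rightarrow> 'v set set \<Rightarrow> 'v policy \<Rightarrow> 'v measure \<Rightarrow> bool" where
  "stable V H \<Phi> \<mu> \<longleftrightarrow>
     (\<forall>w\<in>buffer_words V H. (\<integral>\<^sup>+\<omega>. ennreal_of_enat (return_time H \<Phi> w \<omega>) \<partial>draws \<mu>) < \<infinity>)"

definition Stab :: "'v set \<Rightarrow> 'v set set \<Rightarrow> 'v policy \<Rightarrow> 'v measure set" where
  "Stab V H \<Phi> = {\<mu> \<in> positive_prob_measures V. stable V H \<Phi> \<mu>}"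

definition non_stabilizable :: "'v set \<Rightarrow> 'v set set \<Rightarrow> bool" where
  "non_stabilizable V H \<longleftrightarrow> (\<forall>\<Phi>. admissible V H \<Phi> \<longrightarrow> Stab V H \<Phi> = {})"

end

theory Submission imports Defs begin

text \<open>
  A transversal of cardinality one is a class \<open>a\<close> that belongs to every hyperedge. Each match
  then consumes exactly one item of class \<open>a\<close> and \<open>r - 1\<close> other items, whatever the policy does,
  so it leaves the imbalance "number of other items minus \<open>r - 1\<close> times the number of items of
  class \<open>a\<close>" of the system unchanged. Hence the imbalance of the buffer is a random walk driven by
  the arrivals alone: it goes up by \<open>1\<close> when another class arrives and down by \<open>r - 1\<close> when \<open>a\<close>
  arrives. Both events have positive probability, because \<open>r \<ge> 2\<close> provides a class other than
  \<open>a\<close>. The empty buffer has imbalance \<open>0\<close>, so it cannot recur faster than the walk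
  returns to \<open>0\<close>, and a nondegenerate walk with bounded steps never returns to \<open>0\<close>
  in finite mean time (\<open>infinite_mean_return_time\<close>).

  The last fact is proved without the strong law or Wald's identities, in a way that treats
  null recurrence and transience together. Up to a sign, the drift is nonnegative. Let \<open>T\<close> be the
  return time to the base state, \<open>\<phi>\<close> the position of the walk, and \<open>\<psi> = max \<phi> 0\<close>. Since \<open>\<psi>\<close>
  vanishes at the base state and is a submartingale, the expectation of \<open>\<psi>\<close> at time \<open>n\<close> on the
  event \<open>T > n\<close> is nondecreasing in \<open>n\<close>, and it is positive at \<open>n = 1\<close>. On the other hand, as the steps
  are bounded by \<open>K\<close>, a chain at height \<open>\<psi>\<close> needs at least \<open>\<psi> / K\<close> further steps to return, so
  that expectation is at most \<open>K\<close> times the sum of the probabilities of \<open>T > k\<close> over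
  \<open>k \<ge> n\<close>. If \<open>T\<close> had finite mean, this tail would tend to \<open>0\<close>: a contradiction.
\<close>

section \<open>Two facts on extended nonnegative numbers\<close>

lemma ennreal_suminf_tail_tendsto:
  fixes g :: "nat \<Rightarrow> ennreal"
  assumes "(\<Sum>k. g k) \<noteq> \<infinity>"
  shows "(\<lambda>n. \<Sum>k. g (k + n)) \<longlonglongrightarrow> 0"
proof -
  have part: "(\<Sum>k<n. g k) \<noteq> \<infinity>" for n
  proof -
    have "(\<Sum>k<n. g k) \<le> (\<Sum>k. g k)" by (rule sum_le_suminf) auto
    then show ?thesis using assms by (metis infinity_ennreal_def top_unique)
  qed
  have "(\<Sum>k. g (k + n)) = (\<Sum>k. g k) - (\<Sum>k<n. g k)" for n
    using suminf_offset[of g n] part[of n] by (simp add: add_diff_eq_ennreal)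
  moreover have "(\<lambda>n. (\<Sum>k. g k) - (\<Sum>k<n. g k)) \<longlonglongrightarrow> (\<Sum>k. g k) - (\<Sum>k. g k)"
    using assms by (intro tendsto_diff_ennreal tendsto_const summable_LIMSEQ) auto
  ultimately show ?thesis using assms by simp
qed

lemma card_below_enat_le: "of_nat (card {k\<in>{..<N}. enat k < T}) \<le> ennreal_of_enat T"
proof (cases T)
  case (enat t)
  have "card {k\<in>{..<N}. k < t} \<le> card {..<t}" by (intro card_mono) auto
  then show ?thesis by (simp add: enat)
qed simp

section \<open>Chains driven by independent draws\<close>

primrec orbit :: "('s \<Rightarrow> 'x \<Rightarrow> 's) \<Rightarrow> 's \<Rightarrow> 'x stream \<Rightarrow> nat \<Rightarrow> 's" where
  "orbit f w \<omega> 0 = w"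
| "orbit f w \<omega> (Suc n) = f (orbit f w \<omega> n) (\<omega> !! n)"

lemma orbit_SCons: "orbit f w (x ## \<omega>) (Suc n) = orbit f (f w x) \<omega> n"
  by (induction n) auto

text \<open>
  Countability of the state space makes every function of the state measurable and lets
  measurability of one step pass to iterated steps.
\<close>

locale random_recursion = prob_space M for M :: "'x measure" +
  fixes B :: "'s set" and f :: "'s \<Rightarrow> 'x \<Rightarrow> 's" and s :: 's
  assumes countable_states: "countable B"
    and base_state: "s \<in> B"
    and measurable_step: "w \<in> B \<Longrightarrow> f w \<in> M \<rightarrow>\<^sub>M count_space B"
begin

lemma step_in: "w \<in> B \<Longrightarrow> x \<in> space M \<Longrightarrow> f w x \<in> B"
  using measurable_space[OF measurable_step] by simp

lemma measurable_after_step: "w \<in> B \<Longrightarrow> (\<lambda>x. F (f w x) :: ennreal) \<in> borel_measurable M"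
  by (rule measurable_compose[OF measurable_step]) auto

text \<open>
  The \<open>n\<close>-th power of the transition operator of the chain that is killed when it visits \<open>s\<close>:
  \<open>killed n u w\<close> is the expectation of \<open>u\<close> at time \<open>n\<close> for the chain started in \<open>w\<close>, on the event
  that it avoids \<open>s\<close> at the times \<open>1, \<dots>, n\<close>. The starting point itself may be \<open>s\<close>. Recursion
  on the first step replaces conditioning on the past.
\<close>

primrec killed :: "nat \<Rightarrow> ('s \<Rightarrow> ennreal) \<Rightarrow> 's \<Rightarrow> ennreal" where
  "killed 0 u w = u w"
| "killed (Suc n) u w = (\<integral>\<^sup>+x. (if f w x = s then 0 else killed n u (f w x)) \<partial>M)"

lemma killed_mono:
  assumes "\<And>y. y \<in> B \<Longrightarrow> u y \<le> v y" and "w \<in> B"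
  shows "killed n u w \<le> killed n v w"
  using assms(2)
proof (induction n arbitrary: w)
  case (Suc n)
  then show ?case by (auto intro!: nn_integral_mono simp: step_in)
qed (simp add: assms(1))

lemma killed_cmult: "w \<in> B \<Longrightarrow> killed n (\<lambda>y. c * u y) w = c * killed n u w"
proof (induction n arbitrary: w)
  case (Suc n)
  have "killed (Suc n) (\<lambda>y. c * u y) w = (\<integral>\<^sup>+x. c * (if f w x = s then 0 else killed n u (f w x)) \<partial>M)"
    using Suc by (auto intro!: nn_integral_cong simp: step_in)
  also have "\<dots> = c * killed (Suc n) u w"
    using measurable_after_step[OF Suc.prems, of "\<lambda>y. if y = s then 0 else killed n u y"]
    by (simp add: nn_integral_cmult)
  finally show ?case .
qed simp

text \<open>
  With \<open>u = 1\<close>, the inner sum is the mean time to reach \<open>s\<close>. Averaging it over the killed chain at time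
  \<open>n\<close> leaves the tail of the series, that is, the mean remaining time after \<open>n\<close>.
\<close>

lemma killed_suminf:
  "w \<in> B \<Longrightarrow> killed n (\<lambda>y. \<Sum>k. killed k u y) w = (\<Sum>k. killed (n + k) u w)"
proof (induction n arbitrary: w)
  case (Suc n)
  have "killed (Suc n) (\<lambda>y. \<Sum>k. killed k u y) w
      = (\<integral>\<^sup>+x. (\<Sum>k. if f w x = s then 0 else killed (n + k) u (f w x)) \<partial>M)"
    using Suc by (auto intro!: nn_integral_cong simp: step_in)
  also have "\<dots> = (\<Sum>k. \<integral>\<^sup>+x. (if f w x = s then 0 else killed (n + k) u (f w x)) \<partial>M)"
    using measurable_after_step[OF Suc.prems, of "\<lambda>y. if y = s then 0 else killed (n + _) u y"]
    by (intro nn_integral_suminf)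
  finally show ?case by simp
qed simp

text \<open>
  A submartingale for the killed chain stays one after each step, because the operator is monotone.
\<close>

lemma killed_increasing:
  assumes "\<And>y. y \<in> B \<Longrightarrow> u y \<le> killed 1 u y" and "w \<in> B"
  shows "killed n u w \<le> killed (Suc n) u w"
  using assms(2)
proof (induction n arbitrary: w)
  case 0
  then show ?case using assms(1)[of w] by simp
next
  case (Suc n)
  have "killed (Suc n) u w \<le> (\<integral>\<^sup>+x. (if f w x = s then 0 else killed (Suc n) u (f w x)) \<partial>M)"
    unfolding killed.simps(2)[of n]
    using Suc.IH[unfolded killed.simps(2)[of n]] Suc.prems
    by (intro nn_integral_mono) (auto simp: step_in)
  then show ?case by simp
qed

lemma measurable_orbit:
  assumes "w \<in> B"
  shows "(\<lambda>\<omega>. orbit f w \<omega> n) \<in> stream_space M \<rightarrow>\<^sub>M count_space B"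
proof (induction n)
  case 0
  then show ?case using assms by simp
next
  case (Suc n)
  have "(\<lambda>\<omega>. f y (\<omega> !! n)) \<in> stream_space M \<rightarrow>\<^sub>M count_space B" if "y \<in> B" for y
    by (rule measurable_compose[OF _ measurable_step[OF that]]) measurable
  from measurable_compose_countable'[OF this Suc.IH countable_states]
  show ?case by simp
qed

abbreviation avoids :: "'s \<Rightarrow> nat \<Rightarrow> 'x stream \<Rightarrow> bool" where
  "avoids w n \<omega> \<equiv> \<forall>j<n. orbit f w \<omega> (Suc j) \<noteq> s"

lemma measurable_avoids:
  assumes "w \<in> B"
  shows "(\<lambda>\<omega>. if avoids w n \<omega> then 1 else 0 :: ennreal) \<in> borel_measurable (stream_space M)"
proof -
  have "Measurable.pred (stream_space M) (\<lambda>\<omega>. orbit f w \<omega> j \<noteq> s)" for j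
    by (rule measurable_compose[OF measurable_orbit[OF assms]]) simp
  from this[measurable] show ?thesis by measurable
qed

lemma killed_eq_avoids:
  "w \<in> B \<Longrightarrow> killed n (\<lambda>_. 1) w = (\<integral>\<^sup>+\<omega>. (if avoids w n \<omega> then 1 else 0) \<partial>stream_space M)"
proof (induction n arbitrary: w)
  case 0
  interpret S: prob_space "stream_space M" by (rule prob_space_stream_space)
  show ?case by (simp add: S.emeasure_space_1)
next
  case (Suc n)
  have split: "avoids w (Suc n) (x ## \<omega>) \<longleftrightarrow> f w x \<noteq> s \<and> avoids (f w x) n \<omega>" for x \<omega>
    by (simp add: All_less_Suc2 orbit_SCons del: orbit.simps(2))
  have "(\<integral>\<^sup>+\<omega>. (if avoids w (Suc n) \<omega> then 1 else 0) \<partial>stream_space M)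
     = (\<integral>\<^sup>+x. \<integral>\<^sup>+\<omega>. (if avoids w (Suc n) (x ## \<omega>) then 1 else 0) \<partial>stream_space M \<partial>M)"
    by (rule nn_integral_stream_space[OF measurable_avoids[OF Suc.prems]])
  also have "\<dots> = killed (Suc n) (\<lambda>_. 1) w"
    unfolding split killed.simps(2)
    using Suc by (intro nn_integral_cong) (auto simp: step_in)
  finally show ?case by simp
qed

text \<open>
  The mean of a time \<open>T\<close> with values in the extended naturals is the sum of the probabilities of \<open>T > k\<close>,
  and \<open>killed k (\<lambda>_. 1) s\<close> is the probability that the return time to \<open>s\<close> exceeds \<open>k\<close>.
\<close>

lemma mean_return_time_ge:
  "(\<Sum>k. killed k (\<lambda>_. 1) s)
     \<le> (\<integral>\<^sup>+\<omega>. ennreal_of_enat (INF n\<in>{n. n \<ge> 1 \<and> orbit f s \<omega> n = s}. enat n) \<partial>stream_space M)"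
    (is "_ \<le> (\<integral>\<^sup>+\<omega>. ennreal_of_enat (?T \<omega>) \<partial>_)")
proof -
  have avoids_iff: "avoids s k \<omega> \<longleftrightarrow> enat k < ?T \<omega>" for k \<omega>
  proof -
    have "enat (Suc k) \<le> ?T \<omega> \<longleftrightarrow> (\<forall>n. n \<ge> 1 \<and> orbit f s \<omega> n = s \<longrightarrow> Suc k \<le> n)"
      by (simp add: le_INF_iff)
    also have "\<dots> \<longleftrightarrow> avoids s k \<omega>"
      by (metis One_nat_def Suc_le_D Suc_le_mono le_add1 not_less not_less_eq_eq plus_1_eq_Suc)
    finally show ?thesis by (simp add: Suc_ile_eq)
  qed
  have "(\<Sum>k<N. if avoids s k \<omega> then 1 else 0) \<le> ennreal_of_enat (?T \<omega>)" for N \<omega>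
  proof -
    have "(\<Sum>k<N. if avoids s k \<omega> then 1 else 0) = (of_nat (card {k\<in>{..<N}. enat k < ?T \<omega>}) :: ennreal)"
      unfolding avoids_iff by (simp add: sum.If_cases Int_def)
    also have "\<dots> \<le> ennreal_of_enat (?T \<omega>)" by (rule card_below_enat_le)
    finally show ?thesis .
  qed
  then have "(\<integral>\<^sup>+\<omega>. (\<Sum>k<N. if avoids s k \<omega> then 1 else 0) \<partial>stream_space M)
      \<le> (\<integral>\<^sup>+\<omega>. ennreal_of_enat (?T \<omega>) \<partial>stream_space M)" for N
    by (rule nn_integral_mono)
  moreover have "(\<Sum>k<N. killed k (\<lambda>_. 1) s)
      = (\<integral>\<^sup>+\<omega>. (\<Sum>k<N. if avoids s k \<omega> then 1 else 0) \<partial>stream_space M)" for N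
    unfolding killed_eq_avoids[OF base_state]
    by (rule nn_integral_sum[symmetric]) (rule measurable_avoids[OF base_state])
  ultimately have "(\<Sum>k<N. killed k (\<lambda>_. 1) s) \<le> (\<integral>\<^sup>+\<omega>. ennreal_of_enat (?T \<omega>) \<partial>stream_space M)" for N
    by simp
  then show ?thesis by (intro suminf_le_const) auto
qed

text \<open>
  From height above \<open>k K\<close>, descending by at most \<open>K\<close> per step, the chain is still at
  positive height after \<open>k\<close> steps, hence cannot have met \<open>s\<close>, which lies at height \<open>0\<close>.
\<close>

lemma killed_one_far:
  fixes \<phi> :: "'s \<Rightarrow> real"
  assumes "\<phi> s = 0" and "K \<ge> 0"
    and "\<And>w x. w \<in> B \<Longrightarrow> x \<in> space M \<Longrightarrow> \<phi> (f w x) \<ge> \<phi> w - K"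
  shows "w \<in> B \<Longrightarrow> \<phi> w > real k * K \<Longrightarrow> killed k (\<lambda>_. 1) w = 1"
proof (induction k arbitrary: w)
  case (Suc k)
  have far: "\<phi> (f w x) > real k * K" if "x \<in> space M" for x
    using assms(3)[OF Suc.prems(1) that] Suc.prems(2) by (simp add: algebra_simps)
  then have "f w x \<noteq> s" if "x \<in> space M" for x
    using assms(1,2) that by (metis mult_nonneg_nonneg not_less of_nat_0_le_iff)
  then have "killed (Suc k) (\<lambda>_. 1) w = (\<integral>\<^sup>+x. 1 \<partial>M)"
    unfolding killed.simps(2)
    using Suc far by (intro nn_integral_cong) (auto simp: step_in)
  then show ?case by (simp add: emeasure_space_1)
qed simp

text \<open>
  The first \<open>\<lceil>\<phi> w / K\<rceil>\<close> terms of the series equal \<open>1\<close>, so the mean time to reach \<open>s\<close> is at least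
  \<open>\<phi> w / K\<close>.
\<close>

lemma le_sum_killed:
  fixes \<phi> :: "'s \<Rightarrow> real"
  assumes base: "\<phi> s = 0"
    and down: "\<And>w x. w \<in> B \<Longrightarrow> x \<in> space M \<Longrightarrow> \<phi> (f w x) \<ge> \<phi> w - K"
    and "K > 0" and w: "w \<in> B"
  shows "ennreal (\<phi> w) \<le> ennreal K * (\<Sum>k. killed k (\<lambda>_. 1) w)"
proof -
  define m where "m = nat \<lceil>\<phi> w / K\<rceil>"
  have "\<phi> w / K \<le> real m" unfolding m_def by linarith
  then have "\<phi> w \<le> K * real m" using \<open>K > 0\<close> by (simp add: field_simps)
  then have "ennreal (\<phi> w) \<le> ennreal K * of_nat m"
    using \<open>K > 0\<close> by (metis ennreal_leI ennreal_mult ennreal_of_nat_eq_real_of_nat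
        less_imp_le of_nat_0_le_iff)
  also have "of_nat m = (\<Sum>k<m. killed k (\<lambda>_. 1) w)"
  proof -
    have "killed k (\<lambda>_. 1) w = 1" if "k < m" for k
    proof (rule killed_one_far[OF base less_imp_le[OF \<open>K > 0\<close>] down w])
      have "real k < \<phi> w / K" using that unfolding m_def by linarith
      then show "\<phi> w > real k * K" using \<open>K > 0\<close> by (simp add: field_simps)
    qed
    then show ?thesis by simp
  qed
  also have "(\<Sum>k<m. killed k (\<lambda>_. 1) w) \<le> (\<Sum>k. killed k (\<lambda>_. 1) w)"
    by (rule sum_le_suminf) auto
  finally show ?thesis by (simp add: mult_left_mono)
qed

text \<open>
  The walk is a function \<open>\<phi>\<close> of the state, so that the criterion applies to a queue through any count
  that the matching decisions cannot influence. The truncation of \<open>ennreal\<close> at \<open>0\<close> turns \<open>\<phi>\<close>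
  into the submartingale \<open>max \<phi> 0\<close>.
\<close>

theorem infinite_mean_return_time:
  fixes \<phi> :: "'s \<Rightarrow> real" and X :: "'x \<Rightarrow> real"
  assumes base: "\<phi> s = 0"
    and walk: "\<And>w x. w \<in> B \<Longrightarrow> x \<in> space M \<Longrightarrow> \<phi> (f w x) = \<phi> w + X x"
    and X [measurable]: "X \<in> borel_measurable M"
    and bound: "\<And>x. x \<in> space M \<Longrightarrow> \<bar>X x\<bar> \<le> K"
    and drift: "expectation X \<ge> 0"
    and up: "prob {x \<in> space M. X x > 0} > 0"
  shows "(\<integral>\<^sup>+\<omega>. ennreal_of_enat (INF n\<in>{n. n \<ge> 1 \<and> orbit f s \<omega> n = s}. enat n)
           \<partial>stream_space M) = \<infinity>"
proof (rule ccontr)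
  let ?\<psi> = "\<lambda>w. ennreal (\<phi> w)"
  let ?h = "\<lambda>w. \<Sum>k. killed k (\<lambda>_. 1) w"
  assume "\<not> ?thesis"
  then have h_fin: "?h s < \<infinity>"
    by (intro order.strict_trans1[OF mean_return_time_ge]) (simp add: less_top)
  have int: "integrable M X"
    using bound by (intro integrable_const_bound[of _ K]) auto
  obtain x where "x \<in> space M" "X x > 0"
    using up by (metis (mono_tags, lifting) Collect_empty_eq less_irrefl measure_empty)
  then have K: "K > 0" using bound[of x] by linarith
  \<comment> \<open>Killing at \<open>s\<close> costs nothing here, since the height of \<open>s\<close> is \<open>0\<close>.\<close>
  have one_step: "killed 1 ?\<psi> w = (\<integral>\<^sup>+x. ennreal (\<phi> w + X x) \<partial>M)" if "w \<in> B" for w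
    using that base walk by (auto intro!: nn_integral_cong simp flip: walk)
  have sub: "?\<psi> w \<le> killed 1 ?\<psi> w" if "w \<in> B" for w
  proof -
    have "?\<psi> w \<le> ennreal (\<integral>x. \<phi> w + X x \<partial>M)"
      using drift int by (intro ennreal_leI) (simp add: prob_space)
    also have "\<dots> \<le> ennreal (\<integral>x. max 0 (\<phi> w + X x) \<partial>M)"
      using int by (intro ennreal_leI integral_mono) auto
    also have "\<dots> = (\<integral>\<^sup>+x. ennreal (max 0 (\<phi> w + X x)) \<partial>M)"
      using int by (intro nn_integral_eq_integral[symmetric]) auto
    finally show ?thesis using one_step[OF that] by (simp add: max.commute ennreal_max_0)
  qed
  have pos: "0 < killed 1 ?\<psi> s"
  proof (rule ccontr)
    assume "\<not> ?thesis"
    then have "(\<integral>\<^sup>+x. ennreal (X x) \<partial>M) = 0" using one_step[OF base_state] base by simp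
    then have "AE x in M. \<not> X x > 0" by (simp add: nn_integral_0_iff_AE not_less ennreal_eq_0_iff)
    then have "prob {x \<in> space M. X x > 0} = 0" by (subst prob_eq_0) auto
    then show False using up by simp
  qed
  have lower: "killed 1 ?\<psi> s \<le> killed (Suc n) ?\<psi> s" for n
  proof (induction n)
    case (Suc n)
    then show ?case using killed_increasing[OF sub base_state, of "Suc n"] by (rule order_trans)
  qed simp
  have upper: "killed n ?\<psi> s \<le> ennreal K * (\<Sum>k. killed (k + n) (\<lambda>_. 1) s)" for n
  proof -
    have down: "\<phi> (f w x) \<ge> \<phi> w - K" if "w \<in> B" "x \<in> space M" for w x
      using walk[OF that] bound[OF that(2)] by linarith
    have "killed n ?\<psi> s \<le> killed n (\<lambda>w. ennreal K * ?h w) s"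
      by (rule killed_mono[OF le_sum_killed[OF base down K] base_state])
    then show ?thesis
      by (simp add: killed_cmult base_state killed_suminf add.commute)
  qed
  have "(\<lambda>n. \<Sum>k. killed (k + n) (\<lambda>_. 1) s) \<longlonglongrightarrow> 0"
    using h_fin by (intro ennreal_suminf_tail_tendsto) auto
  then have "(\<lambda>n. ennreal K * (\<Sum>k. killed (k + Suc n) (\<lambda>_. 1) s)) \<longlonglongrightarrow> ennreal K * 0"
    by (intro ennreal_tendsto_cmult LIMSEQ_Suc) auto
  then have "killed 1 ?\<psi> s \<le> ennreal K * 0"
    by (rule LIMSEQ_le_const) (use order_trans[OF lower upper] in auto)
  then show False using pos by simp
qed

end

section \<open>The queue when one class belongs to every hyperedge\<close>

lemma possible_matchesD:
  assumes "I \<in> possible_matches H w c"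
  shows "I \<subseteq> {..<length w}" "inj_on ((!) w) I" "c \<notin> (!) w ` I" "insert c ((!) w ` I) \<in> H"
  using assms by (auto simp: possible_matches_def)

lemma admissible_in_possible_matches:
  assumes "admissible V H \<Phi>" "w \<in> buffer_words V H" "c \<in> V" "possible_matches H w c \<noteq> {}"
  shows "\<Phi> w c u \<in> possible_matches H w c"
proof -
  have "\<Phi> w c \<in> borel \<rightarrow>\<^sub>M count_space (possible_matches H w c)"
    using assms by (auto simp: admissible_def)
  from measurable_space[OF this, of u] show ?thesis by simp
qed

text \<open>
  If appending \<open>c\<close> completed a hyperedge, then \<open>c\<close> would belong to it and the other classes of the
  hyperedge would all be present in \<open>w\<close>; one position for each of them would form a possible match.
\<close>

lemma append_in_buffer_words:
  assumes w: "w \<in> buffer_words V H" and c: "c \<in> V" and none: "possible_matches H w c = {}"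
  shows "w @ [c] \<in> buffer_words V H"
proof -
  have "\<exists>i\<in>h. i \<notin> set (w @ [c])" if h: "h \<in> H" for h
  proof (rule ccontr)
    assume "\<not> ?thesis"
    then have sub: "h - {c} \<subseteq> set w" by auto
    have "c \<in> h" using w h sub by (auto simp: buffer_words_def)
    then have "\<forall>i\<in>h - {c}. \<exists>k. k < length w \<and> w ! k = i"
      using sub by (auto simp: in_set_conv_nth subset_iff)
    then obtain p where p: "\<And>i. i \<in> h - {c} \<Longrightarrow> p i < length w \<and> w ! p i = i"
      unfolding bchoice_iff by blast
    have img: "(!) w ` p ` (h - {c}) = h - {c}"
      using p by (force simp: image_image)
    have "p ` (h - {c}) \<in> possible_matches H w c"
      unfolding possible_matches_def mem_Collect_eq img
      using p h \<open>c \<in> h\<close> by (auto simp: inj_on_def insert_absorb)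
    then show False using none by simp
  qed
  then show ?thesis using w c by (auto simp: buffer_words_def)
qed

lemma nths_in_buffer_words: "w \<in> buffer_words V H \<Longrightarrow> nths w I \<in> buffer_words V H"
  using set_nths_subset[of w I] unfolding buffer_words_def mem_Collect_eq lists_eq_set
  by (meson subset_eq)

lemma measurable_step_queue:
  assumes adm: "admissible V H \<Phi>" and w: "w \<in> buffer_words V H" and "finite V"
    and \<mu>: "sets \<mu> = Pow V"
  shows "step H \<Phi> w \<in> \<mu> \<Otimes>\<^sub>M uniform_measure lborel {0..1} \<rightarrow>\<^sub>M count_space (buffer_words V H)"
proof -
  have "step H \<Phi> w \<in> count_space V \<Otimes>\<^sub>M borel \<rightarrow>\<^sub>M count_space (buffer_words V H)"
  proof (rule measurable_pair_measure_countable1)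
    show "countable V" using \<open>finite V\<close> by (rule countable_finite)
    fix c assume c: "c \<in> V"
    show "(\<lambda>u. step H \<Phi> w (c, u)) \<in> borel \<rightarrow>\<^sub>M count_space (buffer_words V H)"
    proof (cases "possible_matches H w c = {}")
      case True
      then show ?thesis using append_in_buffer_words[OF w c] by (simp add: step_def)
    next
      case False
      then have "\<Phi> w c \<in> borel \<rightarrow>\<^sub>M count_space (possible_matches H w c)"
        using adm w c by (auto simp: admissible_def)
      moreover have "(\<lambda>I. nths w (- I)) \<in> count_space (possible_matches H w c)
          \<rightarrow>\<^sub>M count_space (buffer_words V H)"
        using nths_in_buffer_words[OF w] by simp
      ultimately have "(\<lambda>u. nths w (- \<Phi> w c u)) \<in> borel \<rightarrow>\<^sub>M count_space (buffer_words V H)"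
        by (rule measurable_compose)
      then show ?thesis using False by (simp add: step_def)
    qed
  qed
  moreover have same_sets: "sets (\<mu> \<Otimes>\<^sub>M uniform_measure lborel {0..1::real}) = sets (count_space V \<Otimes>\<^sub>M borel)"
    using \<mu> by (intro sets_pair_measure_cong) auto
  ultimately show ?thesis unfolding measurable_cong_sets[OF same_sets refl] by blast
qed

lemma queue_eq_orbit: "queue H \<Phi> w \<omega> n = orbit (step H \<Phi>) w \<omega> n"
  by (induction n) auto

text \<open>
  Counting every item once and subtracting \<open>r\<close> for each item of class \<open>a\<close> gives the number of other
  items minus \<open>r - 1\<close> times the number of items of class \<open>a\<close>.
\<close>

definition imbalance :: "nat \<Rightarrow> 'v \<Rightarrow> 'v list \<Rightarrow> real" where
  "imbalance r a w = real (length w) - real r * real (count_list w a)"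

lemma count_list_nths:
  "count_list (nths w A) a = card {k. k < length w \<and> k \<in> A \<and> w ! k = a}"
proof (induction w rule: rev_induct)
  case (snoc x w)
  have "{k. k < length (w @ [x]) \<and> k \<in> A \<and> (w @ [x]) ! k = a}
      = {k. k < length w \<and> k \<in> A \<and> w ! k = a} \<union>
        (if length w \<in> A \<and> x = a then {length w} else {})"
    by (auto simp: nth_append less_Suc_eq split: if_splits)
  then show ?case using snoc by (simp add: nths_append)
qed simp

text \<open>
  A match removes \<open>r - 1\<close> stored items. If the incoming item is of class \<open>a\<close>, none of them is of class \<open>a\<close>;
  otherwise exactly one is. In both cases the effect on the imbalance is the same as if the
  incoming item had been stored.
\<close>

lemma imbalance_nths:
  assumes I: "I \<in> possible_matches H w c" and "card (insert c ((!) w ` I)) = r"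
    and a: "a \<in> insert c ((!) w ` I)"
  shows "imbalance r a (nths w (- I)) = imbalance r a w + (if c = a then 1 - real r else 1)"
proof -
  note D = possible_matchesD[OF I]
  have fin: "finite I" using D(1) finite_subset by blast
  have "card I = card ((!) w ` I)" using D(2) by (simp add: card_image)
  then have card: "Suc (card I) = r" using assms(2) D(3) fin by simp
  have len: "length (nths w (- I)) + card I = length w"
  proof -
    have "length (nths w (- I)) = card ({..<length w} - I)"
      unfolding length_nths by (rule arg_cong[where f=card]) auto
    also have "\<dots> + card I = length w"
      using card_Diff_subset[OF fin D(1)] card_mono[OF _ D(1)] by simp
    finally show ?thesis .
  qed
  have cnt: "count_list (nths w (- I)) a + card {k\<in>I. w ! k = a} = count_list w a"
  proof -
    have "{k. k < length w \<and> k \<in> UNIV \<and> w ! k = a}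
        = {k. k < length w \<and> k \<in> - I \<and> w ! k = a} \<union> {k\<in>I. w ! k = a}" (is "?A = ?B \<union> ?C")
      using D(1) by auto
    moreover have "card (?B \<union> ?C) = card ?B + card ?C"
      using fin by (intro card_Un_disjoint) auto
    ultimately show ?thesis
      using count_list_nths[of w UNIV a] by (simp add: count_list_nths nths_all)
  qed
  have "card {k\<in>I. w ! k = a} = (if c = a then 0 else 1)"
  proof (cases "c = a")
    case True
    then have "{k\<in>I. w ! k = a} = {}" using D(3) by auto
    then show ?thesis using True by (metis card.empty)
  next
    case False
    then obtain k where "k \<in> I" "w ! k = a" using a by auto
    then have "{k\<in>I. w ! k = a} = {k}" using D(2) by (auto dest: inj_onD)
    then show ?thesis using False by (simp only: card.empty is_singletonI) simp
  qed
  then have cnt': "real (count_list w a)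
      = real (count_list (nths w (- I)) a) + (if c = a then 0 else 1)"
    using cnt by (auto split: if_splits)
  have len': "real (length w) = real (length (nths w (- I))) + (real r - 1)"
    using len card by linarith
  show ?thesis unfolding imbalance_def len' cnt' by (simp add: algebra_simps)
qed

lemma imbalance_step:
  assumes "admissible V H \<Phi>" "w \<in> buffer_words V H" "c \<in> V"
    and "uniform_hypergraph r H" and "\<And>h. h \<in> H \<Longrightarrow> a \<in> h"
  shows "imbalance r a (step H \<Phi> w (c, u)) = imbalance r a w + (if c = a then 1 - real r else 1)"
proof (cases "possible_matches H w c = {}")
  case True
  then show ?thesis by (simp add: step_def imbalance_def algebra_simps)
next
  case False
  note I = admissible_in_possible_matches[OF assms(1-3) False, of u]
  have "insert c ((!) w ` \<Phi> w c u) \<in> H" using I by (rule possible_matchesD(4))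
  with imbalance_nths[OF I, of r a] assms(4,5) False show ?thesis
    unfolding step_def uniform_hypergraph_def prod.case by presburger
qed

lemma transversal_number_oneE:
  assumes hyp: "hypergraph V H" and ne: "{} \<notin> H" and one: "transversal_number V H = 1"
  obtains a where "a \<in> V" and "\<And>h. h \<in> H \<Longrightarrow> a \<in> h"
proof -
  have "finite (transversals V H)"
    using hyp finite_subset[of "transversals V H" "Pow V"]
    by (auto simp: transversals_def hypergraph_def)
  moreover have "V \<in> transversals V H"
  proof -
    have "V \<inter> h = h" if "h \<in> H" for h using hyp that by (auto simp: hypergraph_def)
    then show ?thesis using ne by (auto simp: transversals_def)
  qed
  ultimately have "Min (card ` transversals V H) \<in> card ` transversals V H"
    by (intro Min_in) auto
  then obtain T where T: "T \<in> transversals V H" "card T = 1"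
    using one by (auto simp: transversal_number_def)
  then obtain a where "T = {a}" by (auto simp: card_1_singleton_iff)
  then show thesis using T(1) by (intro that[of a]) (auto simp: transversals_def)
qed

theorem proposition4p5:
  fixes V :: "'v set" and H :: "'v set set" and r :: nat
  assumes "hypergraph V H"
    and "simple_hypergraph H"
    and "connected_hypergraph H"
    and "r \<ge> 2"
    and "uniform_hypergraph r H"
    and "transversal_number V H = 1"
  shows "non_stabilizable V H"
proof -
  have ne: "{} \<notin> H" using assms(4,5) by (auto simp: uniform_hypergraph_def)
  obtain a where a: "a \<in> V" "\<And>h. h \<in> H \<Longrightarrow> a \<in> h"
    using transversal_number_oneE[OF assms(1) ne assms(6)] by blast
  obtain h where h: "h \<in> H" "a \<in> h" using a(1) assms(1) by (auto simp: hypergraph_def)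
  have "\<not> h \<subseteq> {a}"
    using h(1) assms(4,5) card_mono[of "{a}" h] by (auto simp: uniform_hypergraph_def)
  then obtain b where b: "b \<in> V" "b \<noteq> a" using h(1) assms(1) by (auto simp: hypergraph_def)
  have finV: "finite V" using assms(1) by (simp add: hypergraph_def)
  have "\<not> stable V H \<Phi> \<mu>" if adm: "admissible V H \<Phi>" and \<mu>: "\<mu> \<in> positive_prob_measures V" for \<Phi> \<mu>
  proof -
    let ?U = "uniform_measure lborel {0..1::real}"
    let ?M = "\<mu> \<Otimes>\<^sub>M ?U"
    from \<mu> have sets: "sets \<mu> = Pow V" and space: "space \<mu> = V"
      and posm: "\<And>i. i \<in> V \<Longrightarrow> measure \<mu> {i} > 0" and "prob_space \<mu>"
      by (auto simp: positive_prob_measures_def)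
    interpret \<mu>: prob_space \<mu> by fact
    interpret U: prob_space ?U by (rule prob_space_uniform_measure) auto
    interpret P: pair_prob_space \<mu> ?U ..
    have empty: "[] \<in> buffer_words V H" using ne by (auto simp: buffer_words_def ex_in_conv)
    interpret random_recursion ?M "buffer_words V H" "step H \<Phi>" "[]"
    proof
      show "countable (buffer_words V H)"
        using countable_lists[OF countable_finite[OF finV]]
        by (rule countable_subset[rotated]) (auto simp: buffer_words_def)
    qed (use empty measurable_step_queue[OF adm _ finV sets] in auto)
    define Y where "Y = (\<lambda>c. if c = a then 1 - real r else 1)"
    have meas_class: "g \<in> borel_measurable \<mu>" for g :: "'v \<Rightarrow> real"
      by (rule measurableI) (auto simp: sets space)
    have walk: "imbalance r a (step H \<Phi> w x) = imbalance r a w + Y (fst x)"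
      if "w \<in> buffer_words V H" "x \<in> space ?M" for w x
      using imbalance_step[OF adm that(1) _ assms(5) a(2), of "fst x" "snd x"] that(2)
      by (auto simp: Y_def space_pair_measure space)
    have up: "P.prob {x \<in> space ?M. g (fst x) > 0} > 0" if "i \<in> V" "g i > 0" for i and g :: "'v \<Rightarrow> real"
    proof -
      have "emeasure ?M ({i} \<times> UNIV) = emeasure \<mu> {i} * emeasure ?U UNIV"
        using that sets by (intro U.emeasure_pair_measure_Times) auto
      then have "P.prob ({i} \<times> UNIV) = measure \<mu> {i}"
        using U.emeasure_space_1 by (simp add: measure_def)
      moreover have "P.prob ({i} \<times> UNIV) \<le> P.prob {x \<in> space ?M. g (fst x) > 0}"
      proof (rule P.finite_measure_mono)
        show "{i} \<times> UNIV \<subseteq> {x \<in> space ?M. g (fst x) > 0}"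
          using that by (auto simp: space_pair_measure space)
        have "(\<lambda>x. g (fst x)) \<in> borel_measurable ?M"
          by (rule measurable_compose[OF measurable_fst meas_class])
        then show "{x \<in> space ?M. g (fst x) > 0} \<in> P.events" by measurable
      qed
      ultimately show ?thesis using posm[OF that(1)] by linarith
    qed
    have base: "imbalance r a [] = 0" by (simp add: imbalance_def)
    have bound: "\<bar>Y c\<bar> \<le> real r" for c using assms(4) by (simp add: Y_def)
    have meas: "(\<lambda>x. Y (fst x)) \<in> borel_measurable ?M"
      by (rule measurable_compose[OF measurable_fst meas_class])
    have "(\<integral>\<^sup>+\<omega>. ennreal_of_enat (INF n\<in>{n. n \<ge> 1 \<and> orbit (step H \<Phi>) [] \<omega> n = []}. enat n)
           \<partial>stream_space ?M) = \<infinity>"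
    \<comment> \<open>With nonnegative drift the walk goes up at an arrival of \<open>b\<close>; otherwise the reflected
      walk has positive drift and goes up at an arrival of \<open>a\<close>.\<close>
    proof (cases "P.expectation (\<lambda>x. Y (fst x)) \<ge> 0")
      case True
      show ?thesis
        by (rule infinite_mean_return_time[of "imbalance r a" "\<lambda>x. Y (fst x)" "real r"])
          (use base walk meas bound True up[of b Y] b in \<open>auto simp: Y_def\<close>)
    next
      case False
      show ?thesis
        by (rule infinite_mean_return_time[of "\<lambda>w. - imbalance r a w" "\<lambda>x. - Y (fst x)" "real r"])
          (use base walk meas bound False up[of a "\<lambda>c. - Y c"] a(1) assms(4) in \<open>auto simp: Y_def\<close>)
    qed
    then have "(\<integral>\<^sup>+\<omega>. ennreal_of_enat (return_time H \<Phi> [] \<omega>) \<partial>draws \<mu>) = \<infinity>"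
      by (simp add: return_time_def draws_def queue_eq_orbit)
    then have "\<not> (\<integral>\<^sup>+\<omega>. ennreal_of_enat (return_time H \<Phi> [] \<omega>) \<partial>draws \<mu>) < \<infinity>" by simp
    then show ?thesis using empty unfolding stable_def by blast
  qed
  then show ?thesis by (auto simp: non_stabilizable_def Stab_def)
qed

end
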